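(* Let $K$ be a unique factorization domain of characteristic $p>0$. Let $d$ be a nonzero $K$-derivation of the polynomial $K$-algebra $K[x,y]$ such that $d(x)$ and $d(y)$ are coprime. The following conditions are equivalent: (1) $K[x,y]^d=K[x^p,y^p,f]$ for some polynomial $f\in K[x,y]\setminus K[x^p,y^p]$; (2) $d$ is a Jacobian derivation; (3) $d^{\ast}=0$ and $K[x,y]^d\neq K[x^p,y^p]$; (4) $d(f)=0$ and $d(\overline{f})=0$ for some polynomial $f\in K[x,y]\setminus K[x^p,y^p]$, where $\overline{f}=\gcd\left(\frac{\partial f}{\partial x},\frac{\partial f}{\partial y}\right)$.
   Context: For a derivation $d$ of $K[x,y]$, $K[x,y]^d$ denotes its ring of constants, i.e. the kernel of $d$. The divergence of a $K$-derivation $d$ of $K[x,y]$ is the polynomial $d^{\ast}=\frac{\partial (d(x))}{\partial x}+\frac{\partial (d(y))}{\partial y}$. For $f\in K[x,y]$ let $d_f$ be the $K$-derivation of $K[x,y]$ given by $d_f(g)=\operatorname{jac}(f,g)=\frac{\partial f}{\partial x}\frac{\partial g}{\partial y}-\frac{\partial f}{\partial y}\frac{\partial g}{\partial x}$. A derivation of $K[x,y]$ is called a Jacobian derivation if it equals $d_f$ for some $f\in K[x,y]$. Greatest common divisors in $K[x,y]$ are determined up to multiplication by an invertible element of $K$; coprime means that the gcd is invertible. *)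

theory Defs
  imports "Berlekamp_Zassenhaus.Unique_Factorization_Poly"
begin

text \<open>
  The polynomial algebra \<open>K[x,y]\<close> over \<open>K = 'a\<close> is the type \<open>'a poly poly\<close>, read as \<open>K[x][y]\<close>:
  \<open>x\<close> is the variable of the coefficient ring, \<open>y\<close> the outer variable.
  Unique factorization domains are the types of class \<open>ufd\<close>, which fixes no normalization
  and no choice of gcds. Coprimality is \<open>Unique_Factorization.coprime\<close> (every common divisor is
  a unit), because \<open>Rings.coprime\<close> needs a division operation on the type.
\<close>

definition const2 :: "'a::comm_semiring_1 \<Rightarrow> 'a poly poly" where
  "const2 c = [:[:c:]:]"

definition X :: "'a::comm_semiring_1 poly poly" where
  "X = [:[:0, 1:]:]"

definition Y :: "'a::comm_semiring_1 poly poly" where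
  "Y = [:0, 1:]"

definition pderiv_x :: "'a::idom poly poly \<Rightarrow> 'a poly poly" where
  "pderiv_x f = map_poly pderiv f"

definition pderiv_y :: "'a::idom poly poly \<Rightarrow> 'a poly poly" where
  "pderiv_y f = pderiv f"

definition K_derivation :: "('a::idom poly poly \<Rightarrow> 'a poly poly) \<Rightarrow> bool" where
  "K_derivation d \<longleftrightarrow>
     (\<forall>f g. d (f + g) = d f + d g) \<and>
     (\<forall>c f. d (const2 c * f) = const2 c * d f) \<and>
     (\<forall>f g. d (f * g) = d f * g + f * d g)"

definition constants :: "('a::idom poly poly \<Rightarrow> 'a poly poly) \<Rightarrow> 'a poly poly set" where
  "constants d = {f. d f = 0}"

definition divergence :: "('a::idom poly poly \<Rightarrow> 'a poly poly) \<Rightarrow> 'a poly poly" where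
  "divergence d = pderiv_x (d X) + pderiv_y (d Y)"

definition jac :: "'a::idom poly poly \<Rightarrow> 'a poly poly \<Rightarrow> 'a poly poly" where
  "jac f g = pderiv_x f * pderiv_y g - pderiv_y f * pderiv_x g"

definition Jacobian_derivation :: "('a::idom poly poly \<Rightarrow> 'a poly poly) \<Rightarrow> bool" where
  "Jacobian_derivation d \<longleftrightarrow> (\<exists>f. d = jac f)"

text \<open>Closure under negation follows from closure under multiplication by \<open>const2 (- 1)\<close>.\<close>

definition K_subalgebra :: "'a::idom poly poly set \<Rightarrow> bool" where
  "K_subalgebra A \<longleftrightarrow>
     range const2 \<subseteq> A \<and> (\<forall>f\<in>A. \<forall>g\<in>A. f + g \<in> A \<and> f * g \<in> A)"

definition K_adjoin :: "'a::idom poly poly set \<Rightarrow> 'a poly poly set" where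
  "K_adjoin S = K_subalgebra hull S"

end

theory Submission
  imports Defs "HOL-Number_Theory.Cong"
begin

text \<open>
  Write \<open>a = d X\<close>, \<open>b = d Y\<close>, \<open>A = K[x\<^sup>p, y\<^sup>p]\<close>. Since \<open>a\<close> and \<open>b\<close> are coprime, \<open>d u = 0\<close> means that the gradient
  of \<open>u\<close> is \<open>v (b, - a)\<close> for a unique polynomial \<open>v\<close>, and then \<open>d v + v d\<^sup>* = 0\<close>; this gives (3) \<open>\<longleftrightarrow>\<close> (4).
  If \<open>d\<^sup>* = 0\<close>, then \<open>u \<mapsto> v\<close> maps constants to constants, has kernel \<open>A\<close> and lowers leading monomials.
  A constant outside \<open>A\<close> with minimal leading monomial therefore has \<open>v\<close> in \<open>A\<close>, so \<open>b dx - a dy\<close> becomes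
  exact after multiplication by an element of \<open>A\<close> and is exact itself: (2). If \<open>d\<close> is the Jacobian derivation of \<open>f\<close>,
  then \<open>u \<mapsto> v\<close> is differentiation with respect to \<open>f\<close>, and integrating back step by step writes every
  constant as a polynomial in \<open>f\<close> over \<open>A\<close>: (1). The only obstruction would be an antiderivative of
  \<open>f\<^bsup>p-1\<^esup> df\<close>, which leading monomials exclude. Finally, under (1) the factor \<open>h\<close> of the gradient of \<open>f\<close>
  divides the gradient of every constant, and applying this to the constants
  \<open>(d\<^bsup>p-1\<^esup> - \<lambda>) u\<close>, where \<open>d\<^sup>p = \<lambda> d\<close>, forces \<open>h\<close> to be a unit: (4).
\<close>

section \<open>Derivations in characteristic p\<close>

locale derivation =
  fixes D :: "'r::idom \<Rightarrow> 'r"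
  assumes add: "D (u + v) = D u + D v"
    and mult: "D (u * v) = D u * v + u * D v"
begin

lemma zero [simp]: "D 0 = 0"
  by (metis add add_0_right add_left_cancel)

lemma one [simp]: "D 1 = 0"
  by (metis add_left_cancel add_0_right mult mult_1_left mult_1_right)

lemma minus: "D (- u) = - D u"
  using add[of u "- u"] by (simp add: minus_unique)

lemma diff: "D (u - v) = D u - D v"
  using add[of u "- v"] minus[of v] by simp

lemma of_nat [simp]: "D (of_nat n) = 0"
  by (induction n) (simp_all add: add)

lemma sum: "D (sum f S) = (\<Sum>i\<in>S. D (f i))"
  by (induction S rule: infinite_finite_induct) (simp_all add: add)

lemma power: "D (u ^ n) = of_nat n * u ^ (n - 1) * D u"
proof (induction n)
  case (Suc n)
  then show ?case by (cases n) (simp_all add: mult algebra_simps)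
qed simp

lemma iterate_add: "(D ^^ n) (u + v) = (D ^^ n) u + (D ^^ n) v"
  by (induction n) (simp_all add: add)

lemma iterate_zero [simp]: "(D ^^ n) 0 = 0"
  by (induction n) simp_all

lemma iterate_constant_mult: "D c = 0 \<Longrightarrow> (D ^^ n) (c * u) = c * (D ^^ n) u"
  by (induction n) (simp_all add: mult)

lemma iterate_mult:
  "(D ^^ n) (u * v) = (\<Sum>i\<le>n. of_nat (n choose i) * ((D ^^ i) u * (D ^^ (n - i)) v))"
proof (induction n)
  case (Suc n)
  let ?t = "\<lambda>i j. (D ^^ i) u * (D ^^ j) v"
  have "(D ^^ Suc n) (u * v) = (\<Sum>i\<le>n. D (of_nat (n choose i) * ?t i (n - i)))"
    by (simp add: Suc sum)
  also have "\<dots> = (\<Sum>i\<le>n. of_nat (n choose i) * ?t (Suc i) (n - i))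
                  + (\<Sum>i\<le>n. of_nat (n choose i) * ?t i (Suc n - i))"
    by (simp add: mult sum.distrib[symmetric] Suc_diff_le algebra_simps)
  also have "(\<Sum>i\<le>n. of_nat (n choose i) * ?t i (Suc n - i))
     = ?t 0 (Suc n) + (\<Sum>i\<le>n. of_nat (n choose Suc i) * ?t (Suc i) (n - i))"
  proof -
    have "(\<Sum>i\<le>n. of_nat (n choose i) * ?t i (Suc n - i))
        = (\<Sum>i\<le>Suc n. of_nat (n choose i) * ?t i (Suc n - i))"
      by (simp add: binomial_eq_0)
    then show ?thesis
      by (simp add: sum.atMost_Suc_shift del: sum.atMost_Suc)
  qed
  finally show ?case
    by (simp add: sum.atMost_Suc_shift sum.distrib distrib_right add.left_commute del: sum.atMost_Suc funpow.simps)
qed simp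

text \<open>In the Leibniz formula the binomial coefficients with 0 < i < p are divisible by p, so
  only the two end terms survive.\<close>

lemma iterate_prime_char:
  assumes "prime p" and "of_nat p = (0 :: 'r)"
  shows "derivation (D ^^ p)"
proof
  fix u v
  let ?t = "\<lambda>i. of_nat (p choose i) * ((D ^^ i) u * (D ^^ (p - i)) v)"
  have p: "p > 0" using assms(1) prime_gt_0_nat by blast
  have zero: "?t i = 0" if "i \<in> {..p} - {0, p}" for i
  proof -
    have "p dvd p choose i"
      using that by (intro dvd_choose_prime assms) auto
    then obtain k where "p choose i = p * k" ..
    then show ?thesis by (simp add: assms(2))
  qed
  have "(D ^^ p) (u * v) = (\<Sum>i\<in>{0, p}. ?t i)"
    unfolding iterate_mult by (rule sum.mono_neutral_right) (use zero in auto)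
  then show "(D ^^ p) (u * v) = (D ^^ p) u * v + u * (D ^^ p) v"
    using p by simp
qed (rule iterate_add)

end

text \<open>An inverse of \<open>k\<close> modulo p is a natural number, so it maps to an inverse in
  the ring. Hence integers prime to p can be divided by although K need not be a field.\<close>

lemma of_nat_invertible_prime_char:
  assumes "prime p" "of_nat p = (0 :: 'r::comm_semiring_1)" "\<not> p dvd k"
  shows "\<exists>m. of_nat k * of_nat m = (1 :: 'r)"
proof -
  have "Rings.coprime k p"
    using prime_imp_coprime_nat[OF assms(1,3)] by (simp add: Rings.coprime_commute)
  then obtain m where m: "[k * m = 1] (mod p)"
    using cong_solve_coprime_nat by auto
  have "p > 1" using assms(1) prime_gt_1_nat by blast
  then have "(k * m) mod p = 1" using m by (simp add: cong_def)
  then have "k * m = p * (k * m div p) + 1"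
    by (metis div_mult_mod_eq mult.commute)
  then have "(of_nat (k * m) :: 'r) = of_nat p * of_nat (k * m div p) + 1"
    by (metis of_nat_1 of_nat_add of_nat_mult)
  then show ?thesis using assms(2) by (intro exI[of _ m]) simp
qed

lemma fact_invertible_prime_char:
  assumes "prime p" "of_nat p = (0 :: 'r::comm_semiring_1)" "k < p"
  shows "\<exists>m. of_nat (fact k) * of_nat m = (1 :: 'r)"
  using assms by (intro of_nat_invertible_prime_char[of p]) (auto simp: prime_dvd_fact_iff)

text \<open>Repeated integration by parts gives the antiderivative
  \<open>t b - t\<^sup>2 (D b) / 2! + t\<^sup>3 (D\<^sup>2 b) / 3! - \<dots>\<close>, which stops since \<open>D\<close> kills \<open>b\<close> after \<open>p - 1\<close> steps.\<close>

lemma (in derivation) antiderivative_exists: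
  assumes p: "prime p" "of_nat p = (0 :: 'r)" and t: "D t = 1" and b: "(D ^^ (p - 1)) b = 0"
  obtains G where "D G = b"
    and "\<And>E. derivation E \<Longrightarrow> E t = 0 \<Longrightarrow> (\<And>u. E (D u) = D (E u)) \<Longrightarrow> E b = 0 \<Longrightarrow> E G = 0"
proof -
  obtain m where m: "of_nat (fact k) * of_nat (m k) = (1 :: 'r)" if "k < p" for k
    using fact_invertible_prime_char[OF p] by metis
  \<comment> \<open>Here \<open>m k\<close> plays the role of 1/k!. Since
    \<open>D (g k) = w k + w (Suc k)\<close>, the alternating sum of the \<open>D (g k)\<close>
    telescopes to \<open>w 0\<close>, which is \<open>b\<close>.\<close>
  define w where "w k = of_nat (m k) * (t ^ k * (D ^^ k) b)" for k
  define g where "g k = of_nat (m (Suc k)) * (t ^ Suc k * (D ^^ k) b)" for k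
  have p1: "p > 1" using p(1) prime_gt_1_nat by blast
  have m_Suc: "of_nat (Suc k) * of_nat (m (Suc k)) = (of_nat (m k) :: 'r)" if "Suc k < p" for k
  proof -
    have "of_nat (fact k) * (of_nat (Suc k) * of_nat (m (Suc k)) - of_nat (m k)) = (0 :: 'r)"
      using m[of "Suc k"] m[of k] that by (simp add: algebra_simps)
    moreover have "of_nat (fact k) \<noteq> (0 :: 'r)"
      using m[of k] that by (metis Suc_lessD mult_zero_left zero_neq_one)
    ultimately show ?thesis by simp
  qed
  have Dg: "D (g k) = w k + w (Suc k)" if "Suc k < p" for k
  proof -
    have "D (g k) = (of_nat (Suc k) * of_nat (m (Suc k))) * (t ^ k * (D ^^ k) b) + w (Suc k)"
      by (simp add: g_def w_def mult power t algebra_simps del: power_Suc of_nat_Suc)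
    then show ?thesis unfolding m_Suc[OF that] by (simp add: w_def)
  qed
  have tele: "(\<Sum>k<n. (-1) ^ k * D (g k)) = w 0 - (-1) ^ n * w n" if "n < p" for n
    using that by (induction n) (simp_all add: Dg algebra_simps)
  define G where "G = (\<Sum>k<p - 1. (-1) ^ k * g k)"
  have D_sign: "D ((-1) ^ k * u) = (-1) ^ k * D u" for k u
    by (cases "even k") (simp_all add: minus)
  show thesis
  proof
    have "w 0 = b"
      using m[of 0] p1 by (simp add: w_def)
    moreover have "w (p - 1) = 0" using b by (simp add: w_def)
    ultimately show "D G = b"
      using tele[of "p - 1"] p1 by (simp add: G_def sum D_sign)
  next
    \<comment> \<open>Used with \<open>E\<close> the partial derivative in the other variable:
      integrating in one variable then leaves the derivative in the other one zero.\<close>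
    fix E assume "derivation E" and Et: "E t = 0" and commute: "\<And>u. E (D u) = D (E u)" and Eb: "E b = 0"
    then interpret E: derivation E by simp
    have "E ((D ^^ k) b) = 0" for k
      by (induction k) (simp_all add: Eb commute)
    then have "E (g k) = 0" for k
      by (simp add: g_def E.mult E.power Et del: power_Suc)
    moreover have "E ((-1) ^ k * u) = (-1) ^ k * E u" for k u
      by (cases "even k") (simp_all add: E.minus)
    ultimately show "E G = 0" by (simp add: G_def E.sum)
  qed
qed

text \<open>The bracket of the operator \<open>F\<close> with multiplication by \<open>z\<close>. It
  lowers the order of a differential operator, so repeated brackets extract its leading
  symbol.\<close>

definition commutator :: "'r::comm_ring_1 \<Rightarrow> ('r \<Rightarrow> 'r) \<Rightarrow> 'r \<Rightarrow> 'r" where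
  "commutator z F u = F (z * u) - z * F u"

lemma dvd_iterated_commutator:
  assumes "\<And>u. h dvd F u"
  shows "h dvd (commutator z ^^ n) F u"
  using assms by (induction n arbitrary: u) (auto simp: commutator_def)

lemma iterated_commutator_zero: "(commutator z ^^ n) (\<lambda>u. 0) = (\<lambda>u. 0)"
  by (induction n) (auto simp: commutator_def)

lemma iterated_commutator_diff:
  "(commutator z ^^ n) (\<lambda>u. F u - G u) = (\<lambda>u. (commutator z ^^ n) F u - (commutator z ^^ n) G u)"
  by (induction n) (auto simp: commutator_def algebra_simps)

lemma iterated_commutator_mult:
  assumes "n > 0"
  shows "(commutator z ^^ n) (\<lambda>u. c * u) = (\<lambda>u. 0)"
proof -
  have "commutator z (\<lambda>u. c * u) = (\<lambda>u. 0)"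
    by (rule ext) (simp add: commutator_def algebra_simps)
  then show ?thesis
    using assms by (cases n) (simp_all add: funpow_Suc_right iterated_commutator_zero del: funpow.simps)
qed

context derivation
begin

text \<open>The commutator acts on compositions by a product rule and sends \<open>D\<close> to
  multiplication by \<open>D z\<close>. This commutes with \<open>z\<close>, so a second commutator
  kills it and only the first-order correction remains.\<close>

lemma iterated_commutator_comp:
  "(commutator z ^^ n) (\<lambda>u. D (F u))
     = (\<lambda>u. D ((commutator z ^^ n) F u) + of_nat n * D z * (commutator z ^^ (n - 1)) F u)"
proof (induction n)
  case (Suc n)
  show ?case
  proof (rule ext)
    fix u
    have step_mult: "commutator z (\<lambda>u. D (P u) + of_nat n * D z * Q u) u
        = D (commutator z P u) + D z * P u + of_nat n * D z * commutator z Q u" for P Q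
      by (simp add: commutator_def diff mult algebra_simps)
    show "(commutator z ^^ Suc n) (\<lambda>u. D (F u)) u
      = D ((commutator z ^^ Suc n) F u) + of_nat (Suc n) * D z * (commutator z ^^ (Suc n - 1)) F u"
    proof (cases n)
      case (Suc m)
      then have step: "commutator z ((commutator z ^^ (n - 1)) F) = (commutator z ^^ n) F"
        by simp
      have "(commutator z ^^ Suc n) (\<lambda>u. D (F u)) u
          = D (commutator z ((commutator z ^^ n) F) u) + D z * (commutator z ^^ n) F u
            + of_nat n * D z * commutator z ((commutator z ^^ (n - 1)) F) u"
        by (simp only: funpow.simps comp_apply Suc.IH step_mult)
      then show ?thesis unfolding step by (simp add: algebra_simps)
    qed (simp add: commutator_def diff mult algebra_simps)
  qed
qed simp

lemma iterated_commutator_iterate_less: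
  "i < j \<Longrightarrow> (commutator z ^^ j) (D ^^ i) = (\<lambda>u. 0)"
proof (induction i arbitrary: j)
  case 0
  then show ?case using iterated_commutator_mult[where n = j and z = z and c = 1] by (simp add: id_def)
next
  case (Suc i)
  have "D ^^ Suc i = (\<lambda>u. D ((D ^^ i) u))" by auto
  then show ?case
    using Suc.IH[of j] Suc.IH[of "j - 1"] Suc.prems
    by (simp add: iterated_commutator_comp del: funpow.simps)
qed

lemma iterated_commutator_iterate:
  "(commutator z ^^ n) (D ^^ n) = (\<lambda>u. of_nat (fact n) * D z ^ n * u)"
proof (induction n)
  case (Suc n)
  have "D ^^ Suc n = (\<lambda>u. D ((D ^^ n) u))" by auto
  then show ?case
    using Suc iterated_commutator_iterate_less[of n "Suc n" z]
    by (simp add: iterated_commutator_comp algebra_simps del: funpow.simps)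
qed (simp add: id_def)

text \<open>As \<open>E z = 0\<close>, commutators with \<open>z\<close> pass through
  \<open>E\<close>, and n of them reduce the inner operator to multiplication by s = n! (D z)^n.
  Divisibility survives commutators, and E(s t) - t E(s) = s because \<open>E t = 1\<close>.\<close>

lemma dvd_power_of_dvd_derivative:
  assumes E: "derivation E" "E t = 1" "E z = 0"
    and n: "n > 0"
    and dvd: "\<And>u. h dvd E ((D ^^ n) u - c * u)"
  shows "h dvd of_nat (fact n) * D z ^ n"
proof -
  interpret E: derivation E by fact
  have eq: "(commutator z ^^ n) (\<lambda>u. E ((D ^^ n) u - c * u))
      = (\<lambda>u. E (of_nat (fact n) * D z ^ n * u))"
    using n by (simp add: E.iterated_commutator_comp E(3) iterated_commutator_diff
        iterated_commutator_iterate iterated_commutator_mult)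
  have *: "h dvd E (of_nat (fact n) * D z ^ n * u)" for u
    unfolding fun_cong[OF eq, symmetric] by (rule dvd_iterated_commutator) (rule dvd)
  have "h dvd E (of_nat (fact n) * D z ^ n * t) - t * E (of_nat (fact n) * D z ^ n * 1)"
    by (intro dvd_diff dvd_mult *)
  then show ?thesis by (simp add: E.mult E(2) algebra_simps)
qed

end

section \<open>Derivations of the polynomial ring in two variables\<close>

lemma monom_monom:
  fixes c :: "'a::comm_semiring_1"
  shows "monom (monom c i) j = const2 c * X ^ i * Y ^ j"
proof -
  have "X ^ i = [:monom (1::'a) i:]"
    by (induction i) (simp_all add: X_def monom_Suc)
  moreover have "Y ^ j = monom (1::'a poly) j"
    by (simp add: Y_def monom_altdef)
  ultimately show ?thesis
    by (simp add: const2_def smult_monom)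
qed

lemma bivariate_induct [case_names const2 add X Y]:
  assumes "\<And>c. P (const2 c)" "\<And>u v. P u \<Longrightarrow> P v \<Longrightarrow> P (u + v)"
    and "\<And>u. P u \<Longrightarrow> P (X * u)" "\<And>u. P u \<Longrightarrow> P (Y * u)"
  shows "P u"
proof -
  have coeff: "P [:q:]" for q
  proof (induction q)
    case 0
    then show ?case using assms(1)[of 0] by (simp add: const2_def)
  next
    case (pCons c q)
    have "[:pCons c q:] = const2 c + X * [:q:]" by (simp add: const2_def X_def)
    then show ?case using pCons assms by metis
  qed
  show ?thesis
  proof (induction u)
    case 0
    then show ?case using coeff[of 0] by simp
  next
    case (pCons q u)
    have "pCons q u = [:q:] + Y * u" by (simp add: Y_def)
    then show ?case using pCons coeff assms by metis
  qed
qed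

lemma coeff_pderiv_x: "coeff (pderiv_x f) j = pderiv (coeff f j)"
  by (simp add: pderiv_x_def coeff_map_poly)

lemma coeff_coeff_pderiv_x:
  "coeff (coeff (pderiv_x f) j) i = of_nat (Suc i) * coeff (coeff f j) (Suc i)"
  by (simp add: coeff_pderiv_x coeff_pderiv)

lemma coeff_coeff_pderiv_y:
  "coeff (coeff (pderiv_y f) j) i = of_nat (Suc j) * coeff (coeff f (Suc j)) i"
  by (simp add: pderiv_y_def coeff_pderiv of_nat_poly del: of_nat_Suc)

lemma pderiv_x_pderiv_y: "pderiv_x (pderiv_y f) = pderiv_y (pderiv_x f)"
  by (intro poly_eqI) (simp only: coeff_coeff_pderiv_x coeff_coeff_pderiv_y mult.left_commute)

lemma derivation_pderiv_x: "derivation pderiv_x"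
proof
  fix u v :: "'a poly poly"
  show "pderiv_x (u + v) = pderiv_x u + pderiv_x v"
    by (intro poly_eqI) (simp add: coeff_pderiv_x pderiv_add)
  show "pderiv_x (u * v) = pderiv_x u * v + u * pderiv_x v"
  proof (rule poly_eqI)
    fix n
    have "coeff (pderiv_x (u * v)) n = pderiv (\<Sum>i\<le>n. coeff u i * coeff v (n - i))"
      by (simp add: coeff_pderiv_x coeff_mult)
    also have "\<dots> = (\<Sum>i\<le>n. pderiv (coeff u i * coeff v (n - i)))"
      using higher_pderiv_sum[of 1] by simp
    also have "\<dots> = (\<Sum>i\<le>n. pderiv (coeff u i) * coeff v (n - i) + coeff u i * pderiv (coeff v (n - i)))"
      by (simp add: pderiv_mult mult.commute add.commute)
    finally show "coeff (pderiv_x (u * v)) n = coeff (pderiv_x u * v + u * pderiv_x v) n"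
      by (simp add: coeff_mult coeff_pderiv_x sum.distrib)
  qed
qed

lemma derivation_pderiv_y: "derivation pderiv_y"
  by standard (simp_all add: pderiv_y_def pderiv_add pderiv_mult algebra_simps)

interpretation dx: derivation pderiv_x by (rule derivation_pderiv_x)
interpretation dy: derivation pderiv_y by (rule derivation_pderiv_y)

lemma pderiv_x_simps [simp]: "pderiv_x X = 1" "pderiv_x Y = 0" "pderiv_x (const2 c) = 0"
  by (auto intro!: poly_eqI Nat.gr0I simp: coeff_pderiv_x coeff_pderiv X_def Y_def const2_def coeff_pCons split: nat.splits)

lemma pderiv_y_simps [simp]: "pderiv_y X = 0" "pderiv_y Y = 1" "pderiv_y (const2 c) = 0"
  by (simp_all add: pderiv_y_def X_def Y_def const2_def pderiv_pCons)

lemma derivation_if_K_derivation: "K_derivation d \<Longrightarrow> derivation d"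
  by (simp add: K_derivation_def derivation_def)

lemma K_derivation_const2:
  assumes "K_derivation d"
  shows "d (const2 c) = 0"
proof -
  interpret derivation d using assms by (rule derivation_if_K_derivation)
  have "d (const2 c * 1) = const2 c * d 1"
    using assms unfolding K_derivation_def by blast
  then show ?thesis by simp
qed

lemma bivariate_chain_rule:
  assumes "derivation d" "\<And>c. d (const2 c) = 0"
  shows "d u = pderiv_x u * d X + pderiv_y u * d Y"
proof -
  interpret derivation d by fact
  show ?thesis
    by (induction u rule: bivariate_induct)
      (simp_all add: assms(2) add mult dx.add dy.add dx.mult dy.mult algebra_simps)
qed

lemma K_derivation_chain_rule:
  "K_derivation d \<Longrightarrow> d u = pderiv_x u * d X + pderiv_y u * d Y"
  by (intro bivariate_chain_rule derivation_if_K_derivation K_derivation_const2)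

lemma K_derivation_iterate_prime_char:
  fixes d :: "'a::idom poly poly \<Rightarrow> 'a poly poly"
  assumes "K_derivation d" and p: "prime p" "of_nat p = (0 :: 'a)"
  shows "derivation (d ^^ p)"
    and "(d ^^ p) u = pderiv_x u * (d ^^ p) X + pderiv_y u * (d ^^ p) Y"
proof -
  interpret derivation d using assms(1) by (rule derivation_if_K_derivation)
  have p0: "of_nat p = (0 :: 'a poly poly)" by (simp add: of_nat_poly p)
  show der: "derivation (d ^^ p)" by (rule iterate_prime_char[OF p(1) p0])
  have "p > 0" using p(1) prime_gt_0_nat by blast
  then have "(d ^^ p) (const2 c) = 0" for c
    by (cases p) (simp_all add: funpow_Suc_right K_derivation_const2[OF assms(1)] del: funpow.simps)
  then show "(d ^^ p) u = pderiv_x u * (d ^^ p) X + pderiv_y u * (d ^^ p) Y"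
    by (rule bivariate_chain_rule[OF der])
qed

lemma K_derivation_pderiv_x: "K_derivation pderiv_x"
  by (simp add: K_derivation_def dx.add dx.mult)

lemma K_derivation_pderiv_y: "K_derivation pderiv_y"
  by (simp add: K_derivation_def dy.add dy.mult)

text \<open>The p-th iterate is again a derivation and vanishes on both variables since p is at
  least 2.\<close>

lemma iterate_pderiv_prime_char:
  fixes u :: "'a::idom poly poly"
  assumes p: "prime p" "of_nat p = (0 :: 'a)"
  shows "(pderiv_x ^^ p) u = 0" "(pderiv_y ^^ p) u = 0"
proof -
  have "p \<ge> 2" using p(1) prime_ge_2_nat by blast
  then have n: "p = Suc (Suc (p - 2))" by simp
  have "(pderiv_x ^^ p) X = (0 :: 'a poly poly)" "(pderiv_x ^^ p) Y = (0 :: 'a poly poly)"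
    "(pderiv_y ^^ p) X = (0 :: 'a poly poly)" "(pderiv_y ^^ p) Y = (0 :: 'a poly poly)"
    by (subst n, simp add: funpow_Suc_right del: funpow.simps)+
  then show "(pderiv_x ^^ p) u = 0" "(pderiv_y ^^ p) u = 0"
    by (subst K_derivation_iterate_prime_char(2)[OF _ p];
        simp add: K_derivation_pderiv_x K_derivation_pderiv_y)+
qed

lemma K_derivation_jac: "K_derivation (jac f)"
  by (simp add: K_derivation_def jac_def dx.add dx.mult dy.add dy.mult algebra_simps)

lemma divergence_jac: "divergence (jac f) = 0"
  by (simp add: divergence_def jac_def dx.minus dy.minus pderiv_x_pderiv_y)

lemma K_derivation_eqI:
  assumes "K_derivation d" "K_derivation e" "d X = e X" "d Y = e Y"
  shows "d = e"
proof
  show "d u = e u" for u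
    using K_derivation_chain_rule[OF assms(1), of u] K_derivation_chain_rule[OF assms(2), of u]
      assms(3,4) by simp
qed

section \<open>Subalgebras and rings of constants\<close>

lemma K_subalgebra_K_adjoin: "K_subalgebra (K_adjoin S)"
  unfolding K_adjoin_def by (rule hull_in) (auto simp: K_subalgebra_def)

lemma K_adjoin_incl: "f \<in> S \<Longrightarrow> f \<in> K_adjoin S"
  unfolding K_adjoin_def by (rule hull_inc)

lemma K_adjoin_subset: "S \<subseteq> B \<Longrightarrow> K_subalgebra B \<Longrightarrow> K_adjoin S \<subseteq> B"
  unfolding K_adjoin_def by (rule hull_minimal)

lemma K_adjoin_mono: "S \<subseteq> T \<Longrightarrow> K_adjoin S \<subseteq> K_adjoin T"
  unfolding K_adjoin_def by (rule hull_mono)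

context
  fixes B :: "'a::idom poly poly set"
  assumes B: "K_subalgebra B"
begin

lemma subalgebra_const2: "const2 c \<in> B"
  using B by (auto simp: K_subalgebra_def)

lemma subalgebra_add: "f \<in> B \<Longrightarrow> g \<in> B \<Longrightarrow> f + g \<in> B"
  using B by (auto simp: K_subalgebra_def)

lemma subalgebra_mult: "f \<in> B \<Longrightarrow> g \<in> B \<Longrightarrow> f * g \<in> B"
  using B by (auto simp: K_subalgebra_def)

lemma subalgebra_of_nat: "of_nat n \<in> B"
  using subalgebra_const2[of "of_nat n"] by (simp add: const2_def of_nat_poly)

lemma subalgebra_0: "0 \<in> B"
  using subalgebra_of_nat[of 0] by simp

lemma subalgebra_power: "f \<in> B \<Longrightarrow> f ^ n \<in> B"
proof (induction n)
  case 0
  then show ?case using subalgebra_of_nat[of 1] by simp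
qed (simp add: subalgebra_mult)

lemma subalgebra_sum: "(\<And>i. i \<in> I \<Longrightarrow> f i \<in> B) \<Longrightarrow> sum f I \<in> B"
  by (induction I rule: infinite_finite_induct) (simp_all add: subalgebra_0 subalgebra_add)

end

lemma K_subalgebra_constants:
  assumes "K_derivation d"
  shows "K_subalgebra (constants d)"
proof -
  interpret derivation d using assms by (rule derivation_if_K_derivation)
  show ?thesis
    using K_derivation_const2[OF assms] by (auto simp: K_subalgebra_def constants_def add mult)
qed

lemma bivariate_eq_sum_monoms:
  fixes u :: "'a::idom poly poly"
  shows "u = (\<Sum>j\<le>degree u. \<Sum>i\<le>degree (coeff u j). monom (monom (coeff (coeff u j) i) i) j)"
proof -
  have "u = (\<Sum>j\<le>degree u. monom (coeff u j) j)"
    by (simp only: poly_as_sum_of_monoms)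
  also have "\<dots> = (\<Sum>j\<le>degree u. monom (\<Sum>i\<le>degree (coeff u j). monom (coeff (coeff u j) i) i) j)"
    by (simp add: poly_as_sum_of_monoms)
  finally show ?thesis by (simp add: monom_sum)
qed

lemma monom_in_K_adjoin_powers:
  assumes "p dvd i" "p dvd j"
  shows "monom (monom c i) j \<in> K_adjoin {X ^ p, Y ^ p}"
proof -
  let ?A = "K_adjoin {X ^ p, Y ^ p} :: 'a poly poly set"
  note A = K_subalgebra_K_adjoin[of "{X ^ p, Y ^ p} :: 'a poly poly set"]
  obtain k l where "i = p * k" "j = p * l" using assms by (elim dvdE)
  then have "monom (monom c i) j = const2 c * (X ^ p) ^ k * (Y ^ p) ^ l"
    by (simp add: monom_monom power_mult)
  also have "\<dots> \<in> ?A"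
    by (intro subalgebra_mult[OF A] subalgebra_power[OF A] subalgebra_const2[OF A] K_adjoin_incl) auto
  finally show ?thesis .
qed

text \<open>Differentiation multiplies the coefficient of x^i y^j by i or j, which is nonzero in K
  unless p divides it. Vanishing partial derivatives thus leave only exponents divisible by
  p.\<close>

lemma mem_K_adjoin_powers_iff:
  fixes u :: "'a::idom poly poly"
  assumes p: "prime p" "of_nat p = (0 :: 'a)"
  shows "u \<in> K_adjoin {X ^ p, Y ^ p} \<longleftrightarrow> pderiv_x u = 0 \<and> pderiv_y u = 0"
proof
  have p0: "of_nat p = (0 :: 'a poly poly)" by (simp add: of_nat_poly p)
  have "K_adjoin {X ^ p, Y ^ p} \<subseteq> constants pderiv_x \<inter> (constants pderiv_y :: 'a poly poly set)"
    by (intro Int_greatest K_adjoin_subset K_subalgebra_constants K_derivation_pderiv_x K_derivation_pderiv_y)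
      (auto simp: constants_def dx.power dy.power p0)
  then show "u \<in> K_adjoin {X ^ p, Y ^ p} \<Longrightarrow> pderiv_x u = 0 \<and> pderiv_y u = 0"
    by (auto simp: constants_def)
next
  assume zero: "pderiv_x u = 0 \<and> pderiv_y u = 0"
  let ?A = "K_adjoin {X ^ p, Y ^ p} :: 'a poly poly set"
  have A: "K_subalgebra ?A" by (rule K_subalgebra_K_adjoin)
  have not_dvd: "of_nat k \<noteq> (0 :: 'a)" if "\<not> p dvd k" for k
    using of_nat_invertible_prime_char[OF p that] by auto
  have "monom (monom (coeff (coeff u j) i) i) j \<in> ?A" for i j
  proof (cases "coeff (coeff u j) i = 0")
    case False
    have "p dvd i"
    proof (rule ccontr)
      assume "\<not> p dvd i"
      then obtain k where "i = Suc k" by (cases i) auto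
      then show False
        using coeff_coeff_pderiv_x[of u j k] zero False not_dvd[OF \<open>\<not> p dvd i\<close>] by (simp del: of_nat_Suc)
    qed
    moreover have "p dvd j"
    proof (rule ccontr)
      assume "\<not> p dvd j"
      then obtain k where "j = Suc k" by (cases j) auto
      then show False
        using coeff_coeff_pderiv_y[of u k i] zero False not_dvd[OF \<open>\<not> p dvd j\<close>] by (simp del: of_nat_Suc)
    qed
    ultimately show ?thesis by (rule monom_in_K_adjoin_powers)
  qed (simp add: subalgebra_0[OF A])
  then have "(\<Sum>j\<le>degree u. \<Sum>i\<le>degree (coeff u j). monom (monom (coeff (coeff u j) i) i) j) \<in> ?A"
    by (intro subalgebra_sum[OF A])
  then show "u \<in> ?A"
    by (subst bivariate_eq_sum_monoms)
qed

section \<open>Coprime elements\<close>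

lemma coprime_not_both_zero:
  fixes a b :: "'r::comm_semiring_1"
  assumes "Unique_Factorization.coprime a b"
  shows "a \<noteq> 0 \<or> b \<noteq> 0"
proof (rule ccontr)
  assume "\<not> (a \<noteq> 0 \<or> b \<noteq> 0)"
  then have "0 dvd (1::'r)" using assms unfolding coprime_def' by blast
  then show False by simp
qed

text \<open>Coprimality makes \<open>b\<close> divide \<open>u\<close> and \<open>a\<close> divide
  \<open>v\<close>; cancelling \<open>b\<close> shows that both quotients agree up to sign. If
  \<open>b = 0\<close>, then \<open>u = 0\<close> and the quotient of \<open>- v\<close> by
  \<open>a\<close> is the witness.\<close>

lemma coprime_syzygy:
  fixes a b u v :: "'r::ufd"
  assumes "Unique_Factorization.coprime a b" and eq: "u * a + v * b = 0"
  obtains w where "u = w * b" "v = - (w * a)"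
proof -
  have cross: "u * a = (- v) * b" using eq by (simp add: eq_neg_iff_add_eq_0)
  note dvd = some_gcd.coprime_mult_cross_dvd[OF assms(1) cross]
  show thesis
  proof (cases "b = 0")
    case True
    then have "a \<noteq> 0" using coprime_not_both_zero[OF assms(1)] by simp
    then have "u = 0" using eq True by simp
    moreover obtain w where "- v = a * w" using dvd(1) by (elim dvdE)
    ultimately show ?thesis
      using that[of w] True by (metis minus_minus mult.commute mult_zero_right)
  next
    case False
    obtain w where w: "u = b * w" using dvd(2) by (elim dvdE)
    have "(w * a) * b = (- v) * b" using cross w by (simp add: ac_simps)
    then have "w * a = - v" using False by (metis mult_right_cancel)
    then have "v = - (w * a)" by (metis minus_minus)
    then show ?thesis using that[of w] w by (simp only: mult.commute)
  qed
qed

text \<open>Cancelling \<open>k\<close> turns the two divisibilities into a syzygy of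
  \<open>a\<close> and \<open>b\<close>, whose factor \<open>w\<close> satisfies
  \<open>v = k * w\<close>.\<close>

lemma dvd_of_dvd_mult_coprime:
  fixes a b k v :: "'r::ufd"
  assumes coprime: "Unique_Factorization.coprime a b" and dvd: "k dvd v * a" "k dvd v * b"
  shows "k dvd v"
proof -
  obtain s t where st: "v * a = k * s" "v * b = k * t" using dvd by (elim dvdE)
  note ab = coprime_not_both_zero[OF coprime]
  show ?thesis
  proof (cases "k = 0")
    case True
    then show ?thesis using st ab by auto
  next
    case False
    have "k * (t * a) = (v * b) * a" by (simp only: st mult.assoc)
    also have "\<dots> = (v * a) * b" by (simp only: ac_simps)
    also have "\<dots> = k * (s * b)" by (simp only: st mult.assoc)
    finally have "t * a = s * b" using False by simp
    then have "t * a + (- s) * b = 0" by simp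
    then obtain w where "t = w * b" "- s = - (w * a)" by (rule coprime_syzygy[OF coprime])
    then have "v * a = (k * w) * a" "v * b = (k * w) * b"
      unfolding st by (simp_all only: minus_minus minus_equation_iff[of s] mult.assoc)
    then have "v = k * w" using ab by (metis mult_right_cancel)
    then show ?thesis by simp
  qed
qed

text \<open>A nonunit has an irreducible factor, which is prime in a UFD and would divide both
  \<open>a\<close> and \<open>b\<close>.\<close>

lemma unit_of_dvd_powers_coprime:
  fixes a b h :: "'r::ufd"
  assumes coprime: "Unique_Factorization.coprime a b" and dvd: "h dvd a ^ m" "h dvd b ^ n"
  shows "h dvd 1"
proof (rule ccontr)
  assume unit: "\<not> h dvd 1"
  have "h \<noteq> 0"
  proof
    assume "h = 0"
    then have "a ^ m = 0" "b ^ n = 0" using dvd by simp_all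
    then have "a = 0" "b = 0" by simp_all
    then show False using coprime_not_both_zero[OF coprime] by simp
  qed
  from mset_factors_exist[OF this unit] obtain F where F: "mset_factors F h" ..
  then obtain q where q: "q \<in># F"
    using mset_factorsD(2)[OF F] by (meson multiset_nonemptyE)
  have irreducible: "irreducible q" and "q dvd h"
    using mset_factorsD(1)[OF F q] mset_factors_imp_dvd[OF F q] .
  then have q_dvd: "q dvd a ^ m" "q dvd b ^ n"
    using dvd dvd_trans by auto
  have "prime_elem q" using irreducible by (rule prime_elem_iff_irreducible[THEN iffD2])
  then have "q dvd a" "q dvd b"
    by (auto intro: prime_elem_dvd_power[OF _ q_dvd(1)] prime_elem_dvd_power[OF _ q_dvd(2)]
        simp del: prime_elem_iff_irreducible)
  then have "q dvd 1" using coprime unfolding coprime_def' by blast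
  then show False using irreducible_not_unit[OF irreducible] by blast
qed

lemma K_derivation_unit:
  fixes h :: "'a::idom poly poly"
  assumes "K_derivation d" "h dvd 1"
  shows "d h = 0"
proof -
  obtain q where q: "h = [:q:]" "q dvd 1"
    using is_unit_poly_iff[THEN iffD1, OF assms(2)] by blast
  obtain c where "q = [:c:]"
    using is_unit_poly_iff[THEN iffD1, OF q(2)] by blast
  then have "h = const2 c" using q by (simp add: const2_def)
  then show ?thesis using K_derivation_const2[OF assms(1)] by simp
qed

section \<open>Leading monomials\<close>

text \<open>Comparison of the exponents of the lexicographically leading monomials, \<open>y\<close> before \<open>x\<close>.\<close>

definition lead_less :: "('a::idom poly poly \<times> 'a poly poly) set" where
  "lead_less = inv_image (less_than <*lex*> less_than) (\<lambda>f. (degree f, degree (lead_coeff f)))"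

lemma wf_lead_less: "wf lead_less"
  by (simp add: lead_less_def wf_lex_prod)

lemma degree_pderiv_less:
  fixes q :: "'r::idom poly"
  assumes "pderiv q \<noteq> 0"
  shows "degree (pderiv q) < degree q"
proof -
  have "coeff (pderiv q) (degree (pderiv q)) \<noteq> 0" using assms by simp
  then have "coeff q (Suc (degree (pderiv q))) \<noteq> 0" by (auto simp: coeff_pderiv)
  then show ?thesis using le_degree Suc_le_lessD by blast
qed

text \<open>Leading exponents add in products. The y-derivative lowers the y-degree; the
  x-derivative either lowers it too or differentiates the leading coefficient.\<close>

lemma lead_less_if_mult_eq_pderiv:
  fixes u v g :: "'a::idom poly poly"
  assumes "v * g = pderiv_x u \<or> v * g = pderiv_y u" "v \<noteq> 0" "g \<noteq> 0"
  shows "(v, u) \<in> lead_less"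
proof -
  have vg: "degree (v * g) = degree v + degree g" "v * g \<noteq> 0"
    using assms(2,3) by (simp_all add: degree_mult_eq)
  have lc: "degree (lead_coeff (v * g)) = degree (lead_coeff v) + degree (lead_coeff g)"
    unfolding lead_coeff_mult using assms(2,3) by (simp add: degree_mult_eq)
  consider "v * g = pderiv_y u" | "v * g = pderiv_x u" using assms(1) by blast
  then show ?thesis
  proof cases
    case 1
    then have "degree (v * g) < degree u"
      using vg(2) by (simp add: pderiv_y_def degree_pderiv_less)
    then show ?thesis using vg by (simp add: lead_less_def)
  next
    case 2
    have le: "degree (v * g) \<le> degree u"
      unfolding 2 pderiv_x_def by (rule degree_map_poly_le)
    show ?thesis
    proof (cases "degree (v * g) = degree u")
      case True
      then have "lead_coeff (v * g) = pderiv (lead_coeff u)"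
        using 2 by (metis coeff_pderiv_x)
      then have "degree (lead_coeff (v * g)) < degree (lead_coeff u)"
        using vg(2) by (metis degree_pderiv_less leading_coeff_0_iff)
      then show ?thesis using vg lc True by (auto simp: lead_less_def)
    next
      case False
      then show ?thesis using le vg by (simp add: lead_less_def)
    qed
  qed
qed

section \<open>Exponents modulo p and antiderivatives\<close>

lemma prime_char_dvd_iff:
  assumes "prime p" "of_nat p = (0 :: 'r::idom)"
  shows "of_nat k = (0 :: 'r) \<longleftrightarrow> p dvd k"
proof (cases "p dvd k")
  case True
  then show ?thesis using assms(2) by (auto elim!: dvdE)
next
  case False
  then show ?thesis using of_nat_invertible_prime_char[OF assms False] by auto
qed

text \<open>The derivative of \<open>P\<close> has no term of degree \<open>- 1\<close> modulo \<open>p\<close>.\<close>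

lemma pderiv_neq_power_mult_pderiv:
  fixes c f P :: "'r::idom poly"
  assumes p: "prime p" "of_nat p = (0 :: 'r)"
    and c: "c \<noteq> 0" "pderiv c = 0" and f: "\<not> p dvd degree f"
  shows "pderiv P \<noteq> c * f ^ (p - 1) * pderiv f"
proof
  assume eq: "pderiv P = c * f ^ (p - 1) * pderiv f"
  note dvd_iff = prime_char_dvd_iff[OF p]
  have p0: "p > 0" using p(1) prime_gt_0_nat by blast
  have n: "degree f > 0" using f by (auto intro: Nat.gr0I)
  then have f0: "f \<noteq> 0" by auto
  have "coeff (pderiv f) (degree f - 1) = of_nat (degree f) * lead_coeff f"
    using n by (simp add: coeff_pderiv del: of_nat_Suc)
  also have "\<dots> \<noteq> 0" using f f0 dvd_iff by simp
  finally have nz: "coeff (pderiv f) (degree f - 1) \<noteq> 0" .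
  then have f'0: "pderiv f \<noteq> 0" by auto
  have f'deg: "degree (pderiv f) = degree f - 1"
    using le_degree[OF nz] degree_pderiv_less[OF f'0] by simp
  have "p dvd degree c"
  proof (cases "degree c")
    case (Suc k)
    have "of_nat (degree c) * lead_coeff c = coeff (pderiv c) k"
      by (simp add: coeff_pderiv Suc del: of_nat_Suc)
    then show ?thesis using c dvd_iff by simp
  qed simp
  let ?q = "c * f ^ (p - 1) * pderiv f"
  have q0: "?q \<noteq> 0" using c f0 f'0 by simp
  \<comment> \<open>Since p divides \<open>degree c\<close>, this degree is -1 modulo p, exactly
    where a derivative has coefficient 0.\<close>
  have "degree ?q = degree c + (p - 1) * degree f + (degree f - 1)"
    using c f0 f'0 f'deg by (simp add: degree_mult_eq degree_power_eq)
  then have "Suc (degree ?q) = degree c + p * degree f"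
    using n p0 by (cases p) auto
  then have "p dvd Suc (degree ?q)" using \<open>p dvd degree c\<close> by simp
  then have "coeff (pderiv P) (degree ?q) = 0"
    using dvd_iff by (simp add: coeff_pderiv del: of_nat_Suc)
  then show False using q0 by (simp add: eq)
qed

text \<open>A change by an element of K[x^p, y^p] does not affect the gradient. After it, a nonzero
  polynomial has a leading monomial with an exponent prime to p.\<close>

lemma remove_p_monomials:
  fixes f :: "'a::idom poly poly"
  obtains g where "f - g \<in> K_adjoin {X ^ p, Y ^ p}"
    and "\<And>i j. p dvd i \<Longrightarrow> p dvd j \<Longrightarrow> coeff (coeff g j) i = 0"
proof -
  let ?A = "K_adjoin {X ^ p, Y ^ p} :: 'a poly poly set"
  have A: "K_subalgebra ?A" by (rule K_subalgebra_K_adjoin)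
  define m where "m i j = monom (monom (coeff (coeff f j) i) i) j" for i j
  define h where "h i j = (if p dvd i \<and> p dvd j then m i j else 0)" for i j
  define g where "g = (\<Sum>j\<le>degree f. \<Sum>i\<le>degree (coeff f j). m i j - h i j)"
  have "f - g = (\<Sum>j\<le>degree f. \<Sum>i\<le>degree (coeff f j). m i j) - g"
    unfolding m_def by (subst bivariate_eq_sum_monoms) (rule refl)
  also have "\<dots> = (\<Sum>j\<le>degree f. \<Sum>i\<le>degree (coeff f j). h i j)"
    by (simp add: g_def sum_subtractf)
  also have "\<dots> \<in> ?A"
    by (intro subalgebra_sum[OF A])
      (simp add: h_def m_def monom_in_K_adjoin_powers subalgebra_0[OF A])
  finally have "f - g \<in> ?A" .
  moreover have "coeff (coeff g j) i = 0" if "p dvd i" "p dvd j" for i j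
    using that by (auto simp: g_def coeff_sum m_def h_def intro!: sum.neutral)
  ultimately show thesis by (rule that)
qed

text \<open>Some exponent of the leading monomial of \<open>f\<close> is prime to p. If it is the
  y-exponent, the one-variable lemma applies over K[x]; otherwise it applies over K to the leading
  coefficients in y.\<close>

lemma no_antiderivative_of_power:
  fixes c f w :: "'a::idom poly poly"
  assumes p: "prime p" "of_nat p = (0 :: 'a)"
    and f: "f \<noteq> 0" "\<And>i j. p dvd i \<Longrightarrow> p dvd j \<Longrightarrow> coeff (coeff f j) i = 0"
    and c: "pderiv_x c = 0" "pderiv_y c = 0"
    and w: "pderiv_x w = c * f ^ (p - 1) * pderiv_x f" "pderiv_y w = c * f ^ (p - 1) * pderiv_y f"
  shows "c = 0"
proof (rule ccontr)
  assume c0: "c \<noteq> 0"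
  have p0: "of_nat p = (0 :: 'a poly)" by (simp add: of_nat_poly p)
  have "coeff (coeff f (degree f)) (degree (lead_coeff f)) \<noteq> 0" using f(1) by simp
  then consider "\<not> p dvd degree f" | "\<not> p dvd degree (lead_coeff f)" using f(2) by blast
  then show False
  proof cases
    case 1
    then show False
      using pderiv_neq_power_mult_pderiv[OF p(1) p0 c0, of f w] c(2) w(2) by (simp add: pderiv_y_def)
  next
    case 2
    let ?g = "lead_coeff f"
    have lc: "pderiv (lead_coeff c) = 0"
      using c(1) by (metis coeff_0 coeff_pderiv_x)
    \<comment> \<open>Otherwise the polynomial 0 would be an antiderivative excluded by the
      one-variable lemma.\<close>
    have "pderiv ?g \<noteq> 0"
    proof
      assume "pderiv ?g = 0"
      then show False
        using pderiv_neq_power_mult_pderiv[OF p, of 1 ?g 0] 2 by simp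
    qed
    then have nz: "coeff (pderiv_x f) (degree f) \<noteq> 0" by (simp add: coeff_pderiv_x)
    have deg: "degree (pderiv_x f) = degree f"
      by (rule antisym) (use nz in \<open>simp_all add: le_degree pderiv_x_def degree_map_poly_le\<close>)
    have "lead_coeff (pderiv_x w) = lead_coeff c * ?g ^ (p - 1) * lead_coeff (pderiv_x f)"
      by (simp only: w lead_coeff_mult lead_coeff_power)
    also have "lead_coeff (pderiv_x f) = pderiv ?g" by (simp only: deg coeff_pderiv_x)
    finally have "pderiv (coeff w (degree (pderiv_x w))) = lead_coeff c * ?g ^ (p - 1) * pderiv ?g"
      by (simp only: coeff_pderiv_x)
    then show False
      using pderiv_neq_power_mult_pderiv[OF p _ lc 2] c0 by auto
  qed
qed

section \<open>Derivations with coprime coordinates\<close>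

lemma constants_iff_gradient:
  fixes d :: "'a::ufd poly poly \<Rightarrow> 'a poly poly"
  assumes "K_derivation d" "Unique_Factorization.coprime (d X) (d Y)"
  shows "d u = 0 \<longleftrightarrow> (\<exists>v. pderiv_x u = v * d Y \<and> pderiv_y u = - (v * d X))"
proof -
  note chain = K_derivation_chain_rule[OF assms(1), of u]
  show ?thesis
  proof
    assume "d u = 0"
    then have "pderiv_x u * d X + pderiv_y u * d Y = 0" using chain by simp
    then obtain v where "pderiv_x u = v * d Y" "pderiv_y u = - (v * d X)"
      by (rule coprime_syzygy[OF assms(2)])
    then show "\<exists>v. pderiv_x u = v * d Y \<and> pderiv_y u = - (v * d X)" by blast
  next
    assume "\<exists>v. pderiv_x u = v * d Y \<and> pderiv_y u = - (v * d X)"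
    then show "d u = 0" using chain by (auto simp: algebra_simps)
  qed
qed

text \<open>Equality of the mixed partial derivatives of \<open>u\<close>.\<close>

lemma gradient_factor_divergence:
  assumes "K_derivation d" and v: "pderiv_x u = v * d Y" "pderiv_y u = - (v * d X)"
  shows "d v + v * divergence d = 0"
proof -
  have "- (pderiv_x v * d X + v * pderiv_x (d X)) = pderiv_y v * d Y + v * pderiv_y (d Y)"
    using pderiv_x_pderiv_y[of u] by (simp add: v dx.minus dx.mult dy.mult)
  then have "pderiv_x v * d X + v * pderiv_x (d X) + (pderiv_y v * d Y + v * pderiv_y (d Y)) = 0"
    by (metis add.right_inverse)
  then show ?thesis
    using K_derivation_chain_rule[OF assms(1), of v]
    by (simp add: divergence_def algebra_simps)
qed

lemma K_adjoin_powers_subset_constants: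
  fixes d :: "'a::idom poly poly \<Rightarrow> 'a poly poly"
  assumes "K_derivation d" "prime p" "of_nat p = (0 :: 'a)"
  shows "K_adjoin {X ^ p, Y ^ p} \<subseteq> constants d"
proof
  fix u :: "'a poly poly" assume "u \<in> K_adjoin {X ^ p, Y ^ p}"
  then show "u \<in> constants d"
    using K_derivation_chain_rule[OF assms(1), of u] mem_K_adjoin_powers_iff[OF assms(2,3)]
    by (simp add: constants_def)
qed

text \<open>Identifies the factor of the gradient with the gcd in condition (4).\<close>

lemma is_gcd_gradient:
  fixes a b :: "'r::ufd"
  assumes "Unique_Factorization.coprime a b" "u = v * b" "w = - (v * a)"
  shows "is_gcd v u w"
proof
  show "v dvd u" "v dvd w" by (simp_all add: assms(2,3))
  show "k dvd v" if "k dvd u" "k dvd w" for k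
  proof (rule dvd_of_dvd_mult_coprime[OF assms(1)])
    show "k dvd v * a" "k dvd v * b" using that by (simp_all add: assms(2,3))
  qed
qed

text \<open>The map \<open>d\<^bsup>p-1\<^esup> - \<lambda>\<close> takes values in the ring of constants, whose elements have partial derivatives
  divisible by \<open>h\<close>. Iterated commutators of its partial derivatives with \<open>X\<close> and \<open>Y\<close> isolate
  the leading symbols \<open>(p-1)! (d Y)\<^bsup>p-1\<^esup>\<close> and \<open>(p-1)! (d X)\<^bsup>p-1\<^esup>\<close>, so \<open>h\<close> divides both.\<close>

lemma common_divisor_gradients_unit:
  fixes d :: "'a::ufd poly poly \<Rightarrow> 'a poly poly"
  assumes p: "prime p" "of_nat p = (0 :: 'a)"
    and d: "K_derivation d" "\<exists>g. d g \<noteq> 0" and coprime: "Unique_Factorization.coprime (d X) (d Y)"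
    and f: "d f = 0" "pderiv_x f \<noteq> 0 \<or> pderiv_y f \<noteq> 0"
    and h: "\<And>u. d u = 0 \<Longrightarrow> h dvd pderiv_x u \<and> h dvd pderiv_y u"
  shows "h dvd 1"
proof -
  interpret d: derivation d using d(1) by (rule derivation_if_K_derivation)
  have p1: "p > 1" using p(1) prime_gt_1_nat by blast
  have iterate_Suc: "(d ^^ p) u = d ((d ^^ (p - 1)) u)" "(d ^^ p) u = (d ^^ (p - 1)) (d u)" for u
    using p1 by (cases p; simp add: funpow_swap1)+
  note chain_p = K_derivation_iterate_prime_char(2)[OF d(1) p]
  obtain v where v: "pderiv_x f = v * d Y" "pderiv_y f = - (v * d X)"
    using f(1) constants_iff_gradient[OF d(1) coprime] by blast
  have v0: "v \<noteq> 0" using f(2) v by auto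
  \<comment> \<open>As \<open>d ^^ p\<close> also kills \<open>f\<close>, its values on
    \<open>X\<close> and \<open>Y\<close> are proportional to those of \<open>d\<close>.\<close>
  have "v * ((d ^^ p) Y * d X + (- (d ^^ p) X) * d Y) = - (d ^^ p) f"
    unfolding chain_p[of f] by (simp add: v algebra_simps)
  also have "\<dots> = 0" by (simp add: iterate_Suc(2) f(1))
  finally have "v * ((d ^^ p) Y * d X + (- (d ^^ p) X) * d Y) = 0" .
  then have "(d ^^ p) Y * d X + (- (d ^^ p) X) * d Y = 0" using v0 by simp
  then obtain l where l: "(d ^^ p) Y = l * d Y" "- (d ^^ p) X = - (l * d X)"
    by (rule coprime_syzygy[OF coprime])
  have dp: "(d ^^ p) u = l * d u" for u
  proof -
    have "(d ^^ p) u = pderiv_x u * (l * d X) + pderiv_y u * (l * d Y)"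
      using chain_p[of u] l by simp
    then show ?thesis
      using K_derivation_chain_rule[OF d(1), of u] by (simp add: algebra_simps)
  qed
  \<comment> \<open>Follows from \<open>d\<close> commuting with its own p-th iterate
    \<open>l * d\<close>, evaluated at some \<open>g\<close> with \<open>d g\<close>
    nonzero.\<close>
  have dl: "d l = 0"
  proof -
    obtain g where g: "d g \<noteq> 0" using d(2) by blast
    have "(d ^^ p) (d g) = d ((d ^^ p) g)" by (simp add: funpow_swap1)
    then have "d l * d g = 0" by (simp add: dp d.mult)
    then show ?thesis using g by simp
  qed
  have "d ((d ^^ (p - 1)) u - l * u) = 0" for u
    using dp[of u] by (simp add: d.diff d.mult dl iterate_Suc(1))
  then have dvd: "h dvd pderiv_x ((d ^^ (p - 1)) u - l * u)"
    "h dvd pderiv_y ((d ^^ (p - 1)) u - l * u)" for u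
    using h by blast+
  have "p - 1 > 0" using p1 by simp
  note symbol = d.dvd_power_of_dvd_derivative[OF _ _ _ this]
  \<comment> \<open>The variable with derivative 1 serves as \<open>t\<close>, the other one as
    \<open>z\<close>.\<close>
  have "h dvd of_nat (fact (p - 1)) * d Y ^ (p - 1)"
    by (rule symbol[where t = X, OF derivation_pderiv_x _ _ dvd(1)]) simp_all
  moreover have "h dvd of_nat (fact (p - 1)) * d X ^ (p - 1)"
    by (rule symbol[where t = Y, OF derivation_pderiv_y _ _ dvd(2)]) simp_all
  moreover obtain m where m: "of_nat (fact (p - 1)) * of_nat m = (1 :: 'a poly poly)"
    using fact_invertible_prime_char[of p "p - 1", where 'r = "'a poly poly"] p p1 by (auto simp: of_nat_poly)
  have cancel: "h dvd u" if "h dvd of_nat (fact (p - 1)) * u" for u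
  proof -
    have "h dvd of_nat m * (of_nat (fact (p - 1)) * u)" using that by (rule dvd_mult)
    also have "of_nat m * (of_nat (fact (p - 1)) * u) = of_nat (fact (p - 1)) * of_nat m * u"
      by (simp only: ac_simps)
    also have "\<dots> = u" by (simp only: m mult_1_left)
    finally show ?thesis .
  qed
  ultimately show ?thesis
    using unit_of_dvd_powers_coprime[OF coprime] cancel by blast
qed

section \<open>The equivalences\<close>

locale coprime_derivation =
  fixes d :: "'a::ufd poly poly \<Rightarrow> 'a poly poly" and p :: nat
  assumes prime: "prime p" and char: "of_nat p = (0 :: 'a)"
    and K_derivation: "K_derivation d" and nonzero: "\<exists>g. d g \<noteq> 0"
    and coprime: "Unique_Factorization.coprime (d X) (d Y)"
begin

sublocale derivation d using K_derivation by (rule derivation_if_K_derivation)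

abbreviation A :: "'a poly poly set" where
  "A \<equiv> K_adjoin {X ^ p, Y ^ p}"

lemmas mem_A_iff = mem_K_adjoin_powers_iff[OF prime char]
lemmas subalgebra_A = K_subalgebra_K_adjoin[of "{X ^ p, Y ^ p} :: 'a poly poly set"]

lemma char_poly: "of_nat p = (0 :: 'a poly poly)"
  by (simp add: of_nat_poly char)

lemma A_subset_constants: "A \<subseteq> constants d"
  by (rule K_adjoin_powers_subset_constants[OF K_derivation prime char])

lemma gradient:
  assumes "d u = 0"
  obtains v where "pderiv_x u = v * d Y" "pderiv_y u = - (v * d X)"
  using assms constants_iff_gradient[OF K_derivation coprime] by blast

lemma gradient_factor_nonzero:
  assumes "u \<notin> A" "pderiv_x u = v * d Y" "pderiv_y u = - (v * d X)"
  shows "v \<noteq> 0"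
  using assms mem_A_iff by auto

text \<open>The polynomials with both partial derivatives divisible by \<open>v\<close> form a
  subalgebra. It contains the generators, hence all constants, which forces \<open>v\<close> to be a
  unit.\<close>

lemma gcd_if_generator:
  assumes f: "f \<notin> A" "constants d = K_adjoin {X ^ p, Y ^ p, f}"
  shows "d f = 0 \<and> (\<exists>h. is_gcd h (pderiv_x f) (pderiv_y f) \<and> d h = 0)"
proof -
  have "f \<in> constants d" unfolding f(2) by (rule K_adjoin_incl) simp
  then have df: "d f = 0" by (simp add: constants_def)
  obtain v where v: "pderiv_x f = v * d Y" "pderiv_y f = - (v * d X)"
    using gradient[OF df] .
  let ?S = "{u. v dvd pderiv_x u \<and> v dvd pderiv_y u}"
  have "K_subalgebra ?S"
    by (auto simp: K_subalgebra_def dx.add dx.mult dy.add dy.mult)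
  moreover have "{X ^ p, Y ^ p, f} \<subseteq> ?S"
    by (auto simp: v dx.power dy.power char_poly)
  ultimately have "constants d \<subseteq> ?S" unfolding f(2) by (intro K_adjoin_subset)
  then have "v dvd pderiv_x u \<and> v dvd pderiv_y u" if "d u = 0" for u
    using that by (auto simp: constants_def)
  then have "v dvd 1"
    using common_divisor_gradients_unit[OF prime char K_derivation nonzero coprime df] f(1) mem_A_iff
    by blast
  then have "d v = 0" by (rule K_derivation_unit[OF K_derivation])
  then show ?thesis using df is_gcd_gradient[OF coprime v] by blast
qed

text \<open>The given gcd and the gradient factor \<open>v\<close> differ by a unit, so
  \<open>d v = 0\<close>, and the divergence identity leaves
  \<open>v * divergence d = 0\<close>.\<close>

lemma divergence_zero_if_gcd:
  assumes f: "f \<notin> A" "d f = 0" and h: "is_gcd h (pderiv_x f) (pderiv_y f)" "d h = 0"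
  shows "divergence d = 0 \<and> constants d \<noteq> A"
proof -
  obtain v where v: "pderiv_x f = v * d Y" "pderiv_y f = - (v * d X)"
    using gradient[OF f(2)] .
  have "v \<noteq> 0" by (rule gradient_factor_nonzero[OF f(1) v])
  have "is_gcd v (pderiv_x f) (pderiv_y f)" by (rule is_gcd_gradient[OF coprime v])
  then have "v dvd h" "h dvd v" using h(1) unfolding is_gcd_def by blast+
  then obtain z where z: "z dvd 1" "v = h * z" using dvd_dvd_imp_unit_mult by blast
  then have "d v = 0"
    using h(2) K_derivation_unit[OF K_derivation z(1)] by (simp add: mult)
  then have "v * divergence d = 0"
    using gradient_factor_divergence[OF K_derivation v] by simp
  then have "divergence d = 0" using \<open>v \<noteq> 0\<close> by simp
  moreover have "f \<in> constants d" using f(2) by (simp add: constants_def)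
  ultimately show ?thesis using f(1) by blast
qed

section \<open>Derivations of divergence zero\<close>

context
  assumes divergence: "divergence d = 0"
begin

lemma gradient_factor_constant:
  assumes "pderiv_x u = v * d Y" "pderiv_y u = - (v * d X)"
  shows "d v = 0"
  using gradient_factor_divergence[OF K_derivation assms] divergence by simp

lemma gradient_factor_lead_less:
  assumes "pderiv_x u = v * d Y" "pderiv_y u = - (v * d X)" "v \<noteq> 0"
  shows "(v, u) \<in> lead_less"
proof -
  have "v * d Y = pderiv_x u" "v * (- d X) = pderiv_y u" using assms by simp_all
  then show ?thesis
    using coprime_not_both_zero[OF coprime] lead_less_if_mult_eq_pderiv[OF _ assms(3)]
    by (metis neg_equal_0_iff_equal)
qed

lemma gcd_if_divergence_zero:
  assumes "constants d \<noteq> A"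
  shows "\<exists>f. f \<notin> A \<and> d f = 0 \<and> (\<exists>h. is_gcd h (pderiv_x f) (pderiv_y f) \<and> d h = 0)"
proof -
  obtain f where f: "f \<notin> A" "d f = 0" using assms A_subset_constants by (auto simp: constants_def)
  obtain v where v: "pderiv_x f = v * d Y" "pderiv_y f = - (v * d X)"
    using gradient[OF f(2)] .
  then show ?thesis
    using f is_gcd_gradient[OF coprime v] gradient_factor_constant[OF v] by blast
qed

text \<open>A constant \<open>g\<close> outside \<open>A\<close> with minimal leading monomial has gradient \<open>v (d Y, - d X)\<close> with \<open>v\<close> in \<open>A\<close>.
  Since the partial derivatives are linear over \<open>A\<close>, this makes \<open>d Y\<close> and \<open>d X\<close> integrable.\<close>

lemma Jacobian_if_divergence_zero:
  assumes "constants d \<noteq> A"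
  shows "Jacobian_derivation d"
proof -
  have "constants d - A \<noteq> {}" using assms A_subset_constants by blast
  then obtain g where g: "g \<in> constants d - A" and
    min: "\<And>v. (v, g) \<in> lead_less \<Longrightarrow> v \<notin> constants d - A"
    using wfE_min[OF wf_lead_less] by (metis ex_in_conv)
  then have dg: "d g = 0" by (simp add: constants_def)
  obtain v where v: "pderiv_x g = v * d Y" "pderiv_y g = - (v * d X)"
    using gradient[OF dg] .
  have v0: "v \<noteq> 0" using gradient_factor_nonzero[OF _ v] g by blast
  have "v \<in> constants d"
    using gradient_factor_constant[OF v] by (simp add: constants_def)
  then have "v \<in> A" using min gradient_factor_lead_less[OF v v0] by blast
  then have v_const: "pderiv_x v = 0" "pderiv_y v = 0" using mem_A_iff by auto
  have "p > 0" using prime prime_gt_0_nat by blast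
  then have Suc: "(F ^^ (p - 1)) (F u) = (F ^^ p) u" for F :: "'a poly poly \<Rightarrow> 'a poly poly" and u
    by (cases p) (simp_all add: funpow_swap1)
  \<comment> \<open>The factor \<open>v\<close> is constant for both partial derivatives, so it can
    be cancelled. What remains is the integrability condition for \<open>d Y\<close> in x, and
    likewise for \<open>- d X\<close> in y.\<close>
  have "v * (pderiv_x ^^ (p - 1)) (d Y) = (pderiv_x ^^ (p - 1)) (pderiv_x g)"
    by (simp add: v dx.iterate_constant_mult[OF v_const(1)])
  also have "\<dots> = 0" by (simp only: Suc iterate_pderiv_prime_char[OF prime char])
  finally have Y: "(pderiv_x ^^ (p - 1)) (d Y) = 0" using v0 by simp
  have "v * (pderiv_y ^^ (p - 1)) (- d X) = (pderiv_y ^^ (p - 1)) (pderiv_y g)"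
    by (simp add: v flip: dy.iterate_constant_mult[OF v_const(2)])
  also have "\<dots> = 0" by (simp only: Suc iterate_pderiv_prime_char[OF prime char])
  finally have X: "(pderiv_y ^^ (p - 1)) (- d X) = 0" using v0 by simp
  obtain G where G: "pderiv_x G = d Y"
    using dx.antiderivative_exists[OF prime char_poly _ Y, of X] by auto
  \<comment> \<open>What \<open>G\<close> still lacks in its y-derivative. Divergence zero makes the
    x-derivative of this remainder vanish, so integrating it in y preserves the x-derivative of
    \<open>G\<close>.\<close>
  let ?r = "- d X - pderiv_y G"
  have "(pderiv_y ^^ (p - 1)) ?r + (pderiv_y ^^ (p - 1)) (pderiv_y G) = 0"
    by (simp only: dy.iterate_add[symmetric] diff_add_cancel X)
  then have r: "(pderiv_y ^^ (p - 1)) ?r = 0"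
    by (simp only: Suc iterate_pderiv_prime_char[OF prime char] add_0_right)
  have "pderiv_x ?r = - divergence d"
    by (simp add: dx.diff dx.minus pderiv_x_pderiv_y G divergence_def)
  then have "pderiv_x ?r = 0" using divergence by simp
  then obtain H where H: "pderiv_y H = ?r" "pderiv_x H = 0"
    using dy.antiderivative_exists[OF prime char_poly _ r, of Y] pderiv_x_pderiv_y
      derivation_pderiv_x by (metis pderiv_x_simps(2) pderiv_y_simps(2))
  have "d = jac (G + H)"
    by (rule K_derivation_eqI[OF K_derivation K_derivation_jac])
      (simp_all add: jac_def dx.add dy.add G H)
  then show ?thesis by (auto simp: Jacobian_derivation_def)
qed

end

lemma divergence_zero_if_Jacobian:
  assumes "Jacobian_derivation d"
  shows "divergence d = 0 \<and> constants d \<noteq> A"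
proof -
  obtain f where f: "d = jac f" using assms by (auto simp: Jacobian_derivation_def)
  have "f \<in> constants d" by (simp add: f constants_def jac_def)
  moreover have "f \<notin> A"
    using nonzero mem_A_iff by (auto simp: f jac_def)
  ultimately show ?thesis using divergence_jac f by blast
qed

text \<open>Without monomials in \<open>x\<^sup>p, y\<^sup>p\<close>, \<open>f\<^bsup>p-1\<^esup> df\<close> has no antiderivative, as its leading monomial shows.
  Hence any constant can be integrated back from its derivative with respect to \<open>f\<close>, which has a smaller
  leading monomial, as a polynomial in \<open>f\<close> of degree less than \<open>p\<close>.\<close>

lemma constant_eq_sum_powers:
  assumes f: "d = jac f" and normal: "\<And>i j. p dvd i \<Longrightarrow> p dvd j \<Longrightarrow> coeff (coeff f j) i = 0"
    and u: "d u = 0"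
  shows "\<exists>c. range c \<subseteq> A \<and> u = (\<Sum>i<p. c i * f ^ i)"
  using wf_lead_less u
proof (induction u rule: wf_induct_rule)
  case (less u)
  have div0: "divergence d = 0" using divergence_jac f by metis
  have grad_f: "pderiv_x f = d Y" "pderiv_y f = - d X" by (simp_all add: f jac_def)
  have f0: "f \<noteq> 0" using nonzero by (auto simp: f jac_def)
  have p0: "p > 0" using prime prime_gt_0_nat by blast
  have const: "\<exists>c. range c \<subseteq> A \<and> w = (\<Sum>i<p. c i * f ^ i)" if "w \<in> A" for w
    using that p0 subalgebra_0[OF subalgebra_A]
    by (intro exI[of _ "\<lambda>i. if i = 0 then w else 0"]) (auto simp: if_distrib[of "\<lambda>t. t * _"] cong: if_cong)
  obtain v where v: "pderiv_x u = v * d Y" "pderiv_y u = - (v * d X)"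
    using gradient[OF less.prems] .
  show ?case
  proof (cases "v = 0")
    case True
    then show ?thesis using const mem_A_iff v by simp
  next
    case False
    have "d v = 0" by (rule gradient_factor_constant[OF div0 v])
    then obtain c where c: "range c \<subseteq> A" "v = (\<Sum>i<p. c i * f ^ i)"
      using less.IH gradient_factor_lead_less[OF div0 v False] by blast
    have grad_c: "pderiv_x (c i) = 0" "pderiv_y (c i) = 0" for i
      using c(1) mem_A_iff by auto
    have "\<exists>m. of_nat (Suc i) * of_nat m = (1 :: 'a poly poly)" if "i < p - 1" for i
      using that by (intro of_nat_invertible_prime_char[OF prime char_poly]) (auto dest: dvd_imp_le)
    then obtain m where m: "of_nat (Suc i) * of_nat (m i) = (1 :: 'a poly poly)" if "i < p - 1" for i
      by metis
    \<comment> \<open>Termwise antiderivative of \<open>v\<close> with respect to \<open>f\<close>,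
      without the top term, for which Suc i = p is not invertible.\<close>
    define s where "s = (\<Sum>i<p - 1. c i * of_nat (m i) * f ^ Suc i)"
    have deriv_s: "D s = (\<Sum>i<p - 1. c i * f ^ i) * D f"
      if D: "derivation D" "\<And>i. D (c i) = 0" for D
    proof -
      interpret D: derivation D by fact
      have "D (c i * of_nat (m i) * f ^ Suc i) = c i * f ^ i * D f" if "i < p - 1" for i
      proof -
        have "D (c i * of_nat (m i) * f ^ Suc i) = (of_nat (Suc i) * of_nat (m i)) * (c i * f ^ i * D f)"
          by (simp add: D.mult D.power D(2) algebra_simps del: power_Suc of_nat_Suc)
        then show ?thesis by (simp only: m[OF that] mult_1_left)
      qed
      then show ?thesis by (simp add: s_def D.sum sum_distrib_right)
    qed
    have split: "v = (\<Sum>i<p - 1. c i * f ^ i) + c (p - 1) * f ^ (p - 1)"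
      using p0 c(2) by (cases p) simp_all
    have grad_u: "pderiv_x u = v * pderiv_x f" "pderiv_y u = v * pderiv_y f"
      by (simp_all add: v grad_f)
    \<comment> \<open>Only the top term is left as gradient of \<open>u - s\<close>, and such an
      antiderivative forces its coefficient to be 0.\<close>
    have w: "pderiv_x (u - s) = c (p - 1) * f ^ (p - 1) * pderiv_x f"
      "pderiv_y (u - s) = c (p - 1) * f ^ (p - 1) * pderiv_y f"
      using deriv_s[OF derivation_pderiv_x] deriv_s[OF derivation_pderiv_y] grad_c
      by (simp_all add: dx.diff dy.diff grad_u split distrib_right)
    have "c (p - 1) = 0"
      by (rule no_antiderivative_of_power[OF prime char f0 normal grad_c w])
    then have mem: "u - s \<in> A" using w mem_A_iff by simp
    \<comment> \<open>Integration shifts the coefficients by one; the vanished top term keeps the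
      degree in \<open>f\<close> below p.\<close>
    define c' where "c' i = (case i of 0 \<Rightarrow> u - s | Suc i \<Rightarrow> c i * of_nat (m i))" for i
    have "(\<Sum>i<Suc (p - 1). c' i * f ^ i) = (u - s) + s"
      unfolding sum.lessThan_Suc_shift by (simp add: c'_def s_def)
    then have "u = (\<Sum>i<p. c' i * f ^ i)" using p0 by simp
    moreover have "c' i \<in> A" for i
    proof (cases i)
      case (Suc k)
      have "c k \<in> A" using c(1) by blast
      then show ?thesis
        unfolding c'_def Suc nat.case by (rule subalgebra_mult[OF subalgebra_A _ subalgebra_of_nat[OF subalgebra_A]])
    qed (simp add: c'_def mem)
    then have "range c' \<subseteq> A" by blast
    ultimately show ?thesis by blast
  qed
qed

text \<open>The given potential is first normalized modulo K[x^p, y^p], which keeps the derivation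
  and enables the leading monomial argument.\<close>

lemma generator_if_Jacobian:
  assumes "Jacobian_derivation d"
  shows "\<exists>f. f \<notin> A \<and> constants d = K_adjoin {X ^ p, Y ^ p, f}"
proof -
  obtain f\<^sub>0 where f\<^sub>0: "d = jac f\<^sub>0" using assms by (auto simp: Jacobian_derivation_def)
  obtain f where diff: "f\<^sub>0 - f \<in> A"
    and normal: "\<And>i j. p dvd i \<Longrightarrow> p dvd j \<Longrightarrow> coeff (coeff f j) i = 0"
    using remove_p_monomials by blast
  then have "pderiv_x f\<^sub>0 = pderiv_x f" "pderiv_y f\<^sub>0 = pderiv_y f"
    using mem_A_iff by (simp_all add: dx.diff dy.diff)
  then have f: "d = jac f" by (simp add: f\<^sub>0 jac_def fun_eq_iff)
  have "f \<notin> A" using nonzero mem_A_iff by (auto simp: f jac_def)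
  let ?B = "K_adjoin {X ^ p, Y ^ p, f}"
  have B: "K_subalgebra ?B" by (rule K_subalgebra_K_adjoin)
  have "A \<subseteq> ?B" by (rule K_adjoin_mono) auto
  have "constants d \<subseteq> ?B"
  proof
    fix u assume "u \<in> constants d"
    then have "d u = 0" by (simp add: constants_def)
    then obtain c where c: "range c \<subseteq> A" "u = (\<Sum>i<p. c i * f ^ i)"
      using constant_eq_sum_powers[OF f normal, of u] by blast
    have "c i \<in> ?B" for i using c(1) \<open>A \<subseteq> ?B\<close> by blast
    moreover have "f \<in> ?B" by (rule K_adjoin_incl) simp
    ultimately show "u \<in> ?B" unfolding c(2)
      by (intro subalgebra_sum[OF B] subalgebra_mult[OF B] subalgebra_power[OF B])
  qed
  moreover have "?B \<subseteq> constants d"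
  proof (rule K_adjoin_subset)
    have "f \<in> constants d" by (simp add: f constants_def jac_def)
    moreover have "{X ^ p, Y ^ p} \<subseteq> A" using K_adjoin_incl by blast
    ultimately show "{X ^ p, Y ^ p, f} \<subseteq> constants d"
      using A_subset_constants by blast
  qed (rule K_subalgebra_constants[OF K_derivation])
  ultimately show ?thesis using \<open>f \<notin> A\<close> by blast
qed

end

theorem theorem4p5:
  fixes d :: "'a::ufd poly poly \<Rightarrow> 'a poly poly" and p :: nat
  assumes "CHAR('a) = p" and "p > 0"
    and "K_derivation d"
    and "\<exists>g. d g \<noteq> 0"
    and "Unique_Factorization.coprime (d X) (d Y)"
  shows "let
      c1 = (\<exists>f. f \<notin> K_adjoin {X ^ p, Y ^ p} \<and> constants d = K_adjoin {X ^ p, Y ^ p, f});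
      c2 = Jacobian_derivation d;
      c3 = (divergence d = 0 \<and> constants d \<noteq> K_adjoin {X ^ p, Y ^ p});
      c4 = (\<exists>f. f \<notin> K_adjoin {X ^ p, Y ^ p} \<and> d f = 0 \<and>
              (\<exists>h. is_gcd h (pderiv_x f) (pderiv_y f) \<and> d h = 0))
    in (c1 \<longleftrightarrow> c2) \<and> (c2 \<longleftrightarrow> c3) \<and> (c3 \<longleftrightarrow> c4)"
proof -
  have "prime p" using assms(1,2) prime_CHAR_semidom[where 'a = 'a] by simp
  moreover have "of_nat p = (0 :: 'a)" using assms(1) of_nat_CHAR[where 'a = 'a] by simp
  ultimately interpret coprime_derivation d p
    using assms(3-5) by unfold_locales
  let ?c1 = "\<exists>f. f \<notin> A \<and> constants d = K_adjoin {X ^ p, Y ^ p, f}"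
  let ?c3 = "divergence d = 0 \<and> constants d \<noteq> A"
  let ?c4 = "\<exists>f. f \<notin> A \<and> d f = 0 \<and> (\<exists>h. is_gcd h (pderiv_x f) (pderiv_y f) \<and> d h = 0)"
  \<comment> \<open>The implications close the cycle (1), (4), (3), (2), (1).\<close>
  have "?c1 \<Longrightarrow> ?c4"
    using gcd_if_generator by meson
  moreover have "?c4 \<Longrightarrow> ?c3"
    by (elim exE conjE) (rule divergence_zero_if_gcd)
  moreover have "?c3 \<Longrightarrow> ?c4"
    by (elim conjE) (rule gcd_if_divergence_zero)
  moreover have "?c3 \<Longrightarrow> Jacobian_derivation d"
    by (elim conjE) (rule Jacobian_if_divergence_zero)
  moreover note divergence_zero_if_Jacobian generator_if_Jacobian
  ultimately show ?thesis
    unfolding Let_def by argo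
qed

end
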